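(* The pushdown to $\mathcal M$ of the metric $h_1$ (the case $c=1$ of the family $h_c$) is $$g_1=\tfrac12\,dR^2+\tfrac12 R\left(u^{-1}|d\mathbf u|^2+v^{-1}|d\mathbf v|^2\right),$$ where $R=u+v$ and $|d\mathbf u|^2=\sum_{i=1}^3 du_i\otimes du_i$, $|d\mathbf v|^2=\sum_{i=1}^3 dv_i\otimes dv_i$.
   Context: Let $x_0,\dots,x_7$ be the standard coordinates on $\mathbb R^8$, with partial derivatives $\partial_i$, and let $e=\sum_i dx_i\otimes dx_i$ and $R=\sum_i x_i^2$. Put $X=-x_1\partial_0+x_0\partial_1-x_3\partial_2+x_2\partial_3-x_5\partial_4+x_4\partial_5-x_7\partial_6+x_6\partial_7$, $Y_1=-x_1\partial_0+x_0\partial_1+x_3\partial_2-x_2\partial_3-x_5\partial_4+x_4\partial_5+x_7\partial_6-x_6\partial_7$, $Y_2=-x_2\partial_0+x_0\partial_2+x_1\partial_3-x_3\partial_1-x_6\partial_4+x_4\partial_6+x_5\partial_7-x_7\partial_5$, $Y_3=-x_3\partial_0+x_0\partial_3+x_2\partial_1-x_1\partial_2-x_7\partial_4+x_4\partial_7+x_6\partial_5-x_5\partial_6$, and $\alpha_i=e(Y_i,\cdot)$. The flow of $Y_1$ is a free circle action on $\mathbb R^8\setminus0$ with quotient $\mathcal C=\mathbb R^+\times\mathbb{CP}^3$; tensors on $\mathcal C$ are identified with their pullbacks to $\mathbb R^8\setminus 0$. For $c<3$, $h_c=\tfrac12dR^2+2R\,e-2\alpha_1^2+(1-c)(\alpha_2^2+\alpha_3^2)$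 defines a Riemannian metric on $\mathcal C$. The vector field $X$ generates a circle action on $\mathcal C$; its quotient is $Q:\mathcal C\to\mathcal M\cong\mathbb R^6\setminus0$, with coordinates $(\mathbf u,\mathbf v)=(u_1,u_2,u_3;v_1,v_2,v_3)$ given by $u_1=x_0^2+x_1^2-x_4^2-x_5^2$, $u_2=2(x_0x_4+x_1x_5)$, $u_3=2(x_0x_5-x_1x_4)$, $v_1=x_2^2+x_3^2-x_6^2-x_7^2$, $v_2=2(x_2x_6+x_3x_7)$, $v_3=2(x_2x_7-x_3x_6)$. Also $u=|\mathbf u|=x_0^2+x_1^2+x_4^2+x_5^2$ and $v=|\mathbf v|=x_2^2+x_3^2+x_6^2+x_7^2$, so $R=u+v$. Let $N_c=h_c(X,X)$ and $\Theta_c=\frac{2}{N_c}h_c(X,\cdot)$. The pushdown of $h_c$ is the Riemannian metric $g_c$ on $\mathcal M$ (where $uv\neq0$) determined by $h_c=Q^*g_c+\tfrac14h_c(X,X)\,\Theta_c\otimes\Theta_c$. *)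

theory Defs
  imports "HOL-Analysis.Analysis"
begin

text \<open>
  Tensor fields on (open subsets of) Euclidean space: the tangent space at every point is the
  ambient vector space, a covector field is a map \<open>x \<mapsto> (a \<mapsto> \<omega> x a)\<close> and a covariant 2-tensor
  field is a map \<open>x \<mapsto> (a, b \<mapsto> h x a b)\<close>.
\<close>

type_synonym 'a one_form = "'a \<Rightarrow> 'a \<Rightarrow> real"
type_synonym 'a two_tensor = "'a \<Rightarrow> 'a \<Rightarrow> 'a \<Rightarrow> real"

definition ext_d :: "('a::real_normed_vector \<Rightarrow> real) \<Rightarrow> 'a one_form" where
  "ext_d f x a = frechet_derivative f (at x) a"

definition tensor_prod :: "'a one_form \<Rightarrow> 'a one_form \<Rightarrow> 'a two_tensor" where
  "tensor_prod \<omega> \<eta> x a b = \<omega> x a * \<eta> x b"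

abbreviation tensor_sq :: "'a one_form \<Rightarrow> 'a two_tensor" where
  "tensor_sq \<omega> \<equiv> tensor_prod \<omega> \<omega>"

definition pullback ::
  "('a::real_normed_vector \<Rightarrow> 'b::real_normed_vector) \<Rightarrow> 'b two_tensor \<Rightarrow> 'a two_tensor" where
  "pullback F g x a b = g (F x) (frechet_derivative F (at x) a) (frechet_derivative F (at x) b)"

text \<open>Meant for open \<open>S\<close>; in finite dimension \<open>Ck_on k S f\<close> then says that \<open>f\<close> is of class \<open>C\<^sup>k\<close> on \<open>S\<close>.\<close>

primrec Ck_on :: "nat \<Rightarrow> 'a::euclidean_space set \<Rightarrow> ('a \<Rightarrow> real) \<Rightarrow> bool" where
  "Ck_on 0 S f \<longleftrightarrow> continuous_on S f"
| "Ck_on (Suc k) S f \<longleftrightarrow> f differentiable_on S \<and> (\<forall>w. Ck_on k S (\<lambda>x. ext_d f x w))"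

definition smooth_on :: "'a::euclidean_space set \<Rightarrow> ('a \<Rightarrow> real) \<Rightarrow> bool" where
  "smooth_on S f \<longleftrightarrow> (\<forall>k. Ck_on k S f)"

definition riemannian_metric_on :: "'a::euclidean_space set \<Rightarrow> 'a two_tensor \<Rightarrow> bool" where
  "riemannian_metric_on S g \<longleftrightarrow>
     open S \<and>
     (\<forall>m\<in>S. bilinear (g m) \<and> (\<forall>a b. g m a b = g m b a) \<and> (\<forall>a. a \<noteq> 0 \<longrightarrow> g m a a > 0)) \<and>
     (\<forall>a b. smooth_on S (\<lambda>m. g m a b))"

text \<open>
  The index type \<open>8\<close> consists of the numerals \<open>0, \<dots>, 7\<close>, so \<open>x $ 0, \<dots>, x $ 7\<close> are the eight
  standard coordinates of \<open>x\<close>.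
\<close>

abbreviation partial :: "8 \<Rightarrow> real^8" where
  "partial i \<equiv> axis i 1"

definition vf_X :: "real^8 \<Rightarrow> real^8" where
  "vf_X x =
     - (x$1) *\<^sub>R partial 0 + (x$0) *\<^sub>R partial 1 - (x$3) *\<^sub>R partial 2 + (x$2) *\<^sub>R partial 3
     - (x$5) *\<^sub>R partial 4 + (x$4) *\<^sub>R partial 5 - (x$7) *\<^sub>R partial 6 + (x$6) *\<^sub>R partial 7"

definition vf_Y1 :: "real^8 \<Rightarrow> real^8" where
  "vf_Y1 x =
     - (x$1) *\<^sub>R partial 0 + (x$0) *\<^sub>R partial 1 + (x$3) *\<^sub>R partial 2 - (x$2) *\<^sub>R partial 3
     - (x$5) *\<^sub>R partial 4 + (x$4) *\<^sub>R partial 5 + (x$7) *\<^sub>R partial 6 - (x$6) *\<^sub>R partial 7"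

definition vf_Y2 :: "real^8 \<Rightarrow> real^8" where
  "vf_Y2 x =
     - (x$2) *\<^sub>R partial 0 + (x$0) *\<^sub>R partial 2 + (x$1) *\<^sub>R partial 3 - (x$3) *\<^sub>R partial 1
     - (x$6) *\<^sub>R partial 4 + (x$4) *\<^sub>R partial 6 + (x$5) *\<^sub>R partial 7 - (x$7) *\<^sub>R partial 5"

definition vf_Y3 :: "real^8 \<Rightarrow> real^8" where
  "vf_Y3 x =
     - (x$3) *\<^sub>R partial 0 + (x$0) *\<^sub>R partial 3 + (x$2) *\<^sub>R partial 1 - (x$1) *\<^sub>R partial 2
     - (x$7) *\<^sub>R partial 4 + (x$4) *\<^sub>R partial 7 + (x$6) *\<^sub>R partial 5 - (x$5) *\<^sub>R partial 6"

definition eucl_e :: "(real^8) two_tensor" where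
  "eucl_e x a b = (\<Sum>i\<in>UNIV. tensor_sq (ext_d (\<lambda>y. y $ i)) x a b)"

definition R8 :: "real^8 \<Rightarrow> real" where
  "R8 x = (\<Sum>i\<in>UNIV. (x $ i)\<^sup>2)"

definition form_alpha1 :: "(real^8) one_form" where
  "form_alpha1 x a = eucl_e x (vf_Y1 x) a"

definition form_alpha2 :: "(real^8) one_form" where
  "form_alpha2 x a = eucl_e x (vf_Y2 x) a"

definition form_alpha3 :: "(real^8) one_form" where
  "form_alpha3 x a = eucl_e x (vf_Y3 x) a"

text \<open>
  The quotient \<open>\<C>\<close> of \<open>\<real>\<^sup>8 - {0}\<close> by the flow of \<open>vf_Y1\<close> is not constructed: its tensors are
  represented by their pullbacks to \<open>\<real>\<^sup>8 - {0}\<close>. In particular \<open>metric_h c\<close> is degenerate along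
  \<open>vf_Y1\<close> as a tensor on \<open>\<real>\<^sup>8\<close>, and \<open>map_Q\<close> below is the composition
  \<open>\<real>\<^sup>8 - {0} \<rightarrow> \<C> \<rightarrow> \<M>\<close>. Here \<open>dR\<^sup>2\<close> is the symmetric square \<open>dR \<otimes> dR\<close>, not \<open>d (R\<^sup>2)\<close>.
\<close>

definition metric_h :: "real \<Rightarrow> (real^8) two_tensor" where
  "metric_h c x a b =
     1/2 * tensor_sq (ext_d R8) x a b + 2 * R8 x * eucl_e x a b
     - 2 * tensor_sq form_alpha1 x a b
     + (1 - c) * (tensor_sq form_alpha2 x a b + tensor_sq form_alpha3 x a b)"

definition fun_N :: "real \<Rightarrow> real^8 \<Rightarrow> real" where
  "fun_N c x = metric_h c x (vf_X x) (vf_X x)"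

definition form_Theta :: "real \<Rightarrow> (real^8) one_form" where
  "form_Theta c x a = 2 / fun_N c x * metric_h c x (vf_X x) a"

definition map_Q :: "real^8 \<Rightarrow> (real^3) \<times> (real^3)" where
  "map_Q x =
    (vector [(x$0)\<^sup>2 + (x$1)\<^sup>2 - (x$4)\<^sup>2 - (x$5)\<^sup>2,
             2 * (x$0 * x$4 + x$1 * x$5),
             2 * (x$0 * x$5 - x$1 * x$4)],
     vector [(x$2)\<^sup>2 + (x$3)\<^sup>2 - (x$6)\<^sup>2 - (x$7)\<^sup>2,
             2 * (x$2 * x$6 + x$3 * x$7),
             2 * (x$2 * x$7 - x$3 * x$6)])"

definition M_u :: "(real^3) \<times> (real^3) \<Rightarrow> real" where
  "M_u m = norm (fst m)"

definition M_v :: "(real^3) \<times> (real^3) \<Rightarrow> real" where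
  "M_v m = norm (snd m)"

definition M_R :: "(real^3) \<times> (real^3) \<Rightarrow> real" where
  "M_R m = M_u m + M_v m"

definition M_reg :: "((real^3) \<times> (real^3)) set" where
  "M_reg = {m. M_u m * M_v m \<noteq> 0}"

definition norm_du_sq :: "((real^3) \<times> (real^3)) two_tensor" where
  "norm_du_sq m a b = (\<Sum>i\<in>UNIV. tensor_sq (ext_d (\<lambda>p. fst p $ i)) m a b)"

definition norm_dv_sq :: "((real^3) \<times> (real^3)) two_tensor" where
  "norm_dv_sq m a b = (\<Sum>i\<in>UNIV. tensor_sq (ext_d (\<lambda>p. snd p $ i)) m a b)"

text \<open>
  Only the values of \<open>g\<close> on \<open>M_reg\<close> are constrained, so the pushdown is unique only as a tensor
  field on \<open>M_reg\<close>.
\<close>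

definition is_pushdown :: "real \<Rightarrow> ((real^3) \<times> (real^3)) two_tensor \<Rightarrow> bool" where
  "is_pushdown c g \<longleftrightarrow>
     riemannian_metric_on M_reg g \<and>
     (\<forall>x. map_Q x \<in> M_reg \<longrightarrow>
        (\<forall>a b. metric_h c x a b =
           pullback map_Q g x a b + 1/4 * fun_N c x * tensor_sq (form_Theta c) x a b))"

end

theory Submission
  imports Defs
begin

text \<open>
  On each of the two factors \<open>\<real>\<^sup>4 = \<complex>\<^sup>2\<close> with coordinates \<open>(x\<^sub>0, x\<^sub>1, x\<^sub>4, x\<^sub>5)\<close> and
  \<open>(x\<^sub>2, x\<^sub>3, x\<^sub>6, x\<^sub>7)\<close> the map \<open>Q\<close> is the Hopf map \<open>H(z, w) = (|z|\<^sup>2 - |w|\<^sup>2, 2 z\<^sup>* w)\<close>, where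
  \<open>z\<^sup>*\<close> is the conjugate of \<open>z\<close>. If \<open>\<theta>\<close> is dual to the rotation field on \<open>\<complex>\<^sup>2\<close> and \<open>u = |H|\<close> then
  \<open>|dH|\<^sup>2 = 4 u e - 4 \<theta>\<^sup>2\<close>. As \<open>X\<close> rotates both factors positively and \<open>Y\<^sub>1\<close> rotates them in opposite
  directions, \<open>\<alpha>\<^sub>1 = \<theta>\<^sub>u - \<theta>\<^sub>v\<close>, \<open>N\<^sub>1 = 8 u v\<close> and \<open>h\<^sub>1(X, \<cdot>) = 4 (v \<theta>\<^sub>u + u \<theta>\<^sub>v)\<close>; the formula for
  \<open>g\<^sub>1\<close> is then the identity
  \<open>(\<theta>\<^sub>u - \<theta>\<^sub>v)\<^sup>2 + (v \<theta>\<^sub>u + u \<theta>\<^sub>v)\<^sup>2 / (u v) = (u + v) (\<theta>\<^sub>u\<^sup>2 / u + \<theta>\<^sub>v\<^sup>2 / v)\<close>.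
  It determines \<open>g\<^sub>1\<close> because \<open>Q\<close> is a surjective submersion over \<open>u v \<noteq> 0\<close>.
\<close>

section \<open>Smooth functions\<close>

lemma ext_d_eq:
  assumes "(f has_derivative D) (at x)"
  shows "ext_d f x w = D w"
  using frechet_derivative_at[OF assms] by (simp add: ext_d_def)

lemma ext_d_has_derivative:
  assumes "open S" "f differentiable_on S" "x \<in> S"
  shows "(f has_derivative ext_d f x) (at x)"
proof -
  have "f differentiable (at x)"
    using assms by (simp add: differentiable_on_eq_differentiable_at)
  then show ?thesis
    by (simp add: frechet_derivative_works ext_d_def[abs_def])
qed

lemma Ck_on_Suc_iff:
  assumes "open S"
  shows "Ck_on (Suc k) S f \<longleftrightarrow>
    (\<forall>x\<in>S. (f has_derivative ext_d f x) (at x)) \<and> (\<forall>w. Ck_on k S (\<lambda>x. ext_d f x w))"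
  using assms ext_d_has_derivative[OF assms]
  by (auto simp: differentiable_on_eq_differentiable_at differentiable_def)

text \<open>On an open set every derivative depends only on the values there. This allows closed
  formulas valid on \<open>M_reg\<close> alone to be used for smoothness.\<close>

lemma Ck_on_cong:
  assumes "open S" "\<And>x. x \<in> S \<Longrightarrow> f x = g x" "Ck_on k S f"
  shows "Ck_on k S g"
  using assms(2,3)
proof (induction k arbitrary: f g)
  case 0
  then show ?case by (simp cong: continuous_on_cong_simp)
next
  case (Suc k)
  have D: "(g has_derivative ext_d f x) (at x)" if "x \<in> S" for x
    using Suc.prems that assms(1)
    by (metis Ck_on_Suc_iff has_derivative_transform_within_open)
  have eq: "ext_d f x w = ext_d g x w" if "x \<in> S" for x w
    using ext_d_eq[OF D[OF that]] by simp
  have "Ck_on k S (\<lambda>x. ext_d g x w)" for w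
    by (rule Suc.IH[of "\<lambda>x. ext_d f x w"]) (use eq Suc.prems in auto)
  moreover have "g differentiable_on S"
    using D assms(1) by (auto simp: differentiable_on_eq_differentiable_at differentiable_def)
  ultimately show ?case by simp
qed

text \<open>Accepts any explicit derivative \<open>D\<close> in place of \<open>ext_d f\<close>, so
  each closure rule below only has to exhibit its differentiation formula.\<close>

lemma Ck_on_SucI:
  assumes "open S"
    and D: "\<And>x. x \<in> S \<Longrightarrow> (f has_derivative D x) (at x)"
    and Ck: "\<And>w. Ck_on k S (\<lambda>x. D x w)"
  shows "Ck_on (Suc k) S f"
proof -
  have eq: "D x w = ext_d f x w" if "x \<in> S" for x w
    using ext_d_eq[OF D[OF that]] by simp
  have "Ck_on k S (\<lambda>x. ext_d f x w)" for w
    by (rule Ck_on_cong[OF assms(1) _ Ck[of w]]) (simp add: eq)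
  moreover have "f differentiable_on S"
    using D assms(1) by (auto simp: differentiable_on_eq_differentiable_at differentiable_def)
  ultimately show ?thesis by simp
qed

text \<open>Product and quotient rules keep undifferentiated factors, which the inductions then need
  at one order lower.\<close>

lemma Ck_on_SucD: "Ck_on (Suc k) S f \<Longrightarrow> Ck_on k S f"
  by (induction k arbitrary: f) (auto intro: differentiable_imp_continuous_on)

lemma Ck_on_const:
  assumes "open S"
  shows "Ck_on k S (\<lambda>x. c)"
proof (induction k arbitrary: c)
  case (Suc k)
  show ?case by (rule Ck_on_SucI[OF assms, where D="\<lambda>x w. 0"]) (auto simp: Suc)
qed auto

lemma Ck_on_bounded_linear:
  assumes "open S" "bounded_linear f"
  shows "Ck_on k S f"
proof (cases k)
  case 0
  then show ?thesis using assms(2) by (simp add: linear_continuous_on)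
next
  case (Suc l)
  show ?thesis unfolding Suc
    by (rule Ck_on_SucI[OF assms(1), where D="\<lambda>x. f"])
       (auto simp: Ck_on_const assms bounded_linear_imp_has_derivative)
qed

lemma Ck_on_add:
  assumes "open S" "Ck_on k S f" "Ck_on k S g"
  shows "Ck_on k S (\<lambda>x. f x + g x)"
  using assms(2,3)
proof (induction k arbitrary: f g)
  case 0
  then show ?case by (auto intro: continuous_intros)
next
  case (Suc k)
  show ?case
    by (rule Ck_on_SucI[OF assms(1), where D="\<lambda>x w. ext_d f x w + ext_d g x w"])
       (use Suc assms(1) in \<open>auto simp del: Ck_on.simps
          simp: Ck_on_Suc_iff intro!: has_derivative_add\<close>)
qed

lemma Ck_on_mult:
  assumes "open S" "Ck_on k S f" "Ck_on k S g"
  shows "Ck_on k S (\<lambda>x. f x * g x)"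
  using assms(2,3)
proof (induction k arbitrary: f g)
  case 0
  then show ?case by (auto intro: continuous_intros)
next
  case (Suc k)
  show ?case
  proof (rule Ck_on_SucI[OF assms(1), where D="\<lambda>x w. f x * ext_d g x w + ext_d f x w * g x"])
    show "((\<lambda>x. f x * g x) has_derivative (\<lambda>w. f x * ext_d g x w + ext_d f x w * g x)) (at x)"
      if "x \<in> S" for x
      using Suc.prems that assms(1)
      by (intro has_derivative_mult) (auto simp del: Ck_on.simps simp: Ck_on_Suc_iff)
    show "Ck_on k S (\<lambda>x. f x * ext_d g x w + ext_d f x w * g x)" for w
      using Suc.prems Ck_on_SucD[OF Suc.prems(1)] Ck_on_SucD[OF Suc.prems(2)]
      by (intro Ck_on_add[OF assms(1)] Suc.IH) auto
  qed
qed

lemma Ck_on_inverse: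
  assumes "open S" "Ck_on k S f" "\<And>x. x \<in> S \<Longrightarrow> f x \<noteq> 0"
  shows "Ck_on k S (\<lambda>x. inverse (f x))"
  using assms(2,3)
proof (induction k arbitrary: f)
  case 0
  then show ?case by (auto intro!: continuous_intros)
next
  case (Suc k)
  show ?case
  proof (rule Ck_on_SucI[OF assms(1),
      where D="\<lambda>x w. (-1) * (inverse (f x) * ext_d f x w * inverse (f x))"])
    show "((\<lambda>x. inverse (f x)) has_derivative
        (\<lambda>w. (-1) * (inverse (f x) * ext_d f x w * inverse (f x)))) (at x)" if "x \<in> S" for x
    proof -
      have "(f has_derivative ext_d f x) (at x)"
        using Suc.prems(1) that assms(1) by (simp del: Ck_on.simps add: Ck_on_Suc_iff)
      from Deriv.has_derivative_inverse[OF Suc.prems(2)[OF that] this] show ?thesis by simp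
    qed
    have "Ck_on k S (\<lambda>x. inverse (f x))"
      using Ck_on_SucD[OF Suc.prems(1)] Suc.prems(2) by (rule Suc.IH)
    then show "Ck_on k S (\<lambda>x. (-1) * (inverse (f x) * ext_d f x w * inverse (f x)))" for w
      using Suc.prems(1) by (intro Ck_on_mult[OF assms(1)] Ck_on_const[OF assms(1)]) auto
  qed
qed

text \<open>The derivative of \<open>norm (L x)\<close> is again built from linear functions and the
  inverse of \<open>norm (L x)\<close>, so the induction on the order closes up.\<close>

lemma Ck_on_norm_linear:
  fixes L :: "'a::euclidean_space \<Rightarrow> 'b::real_inner"
  assumes "open S" "bounded_linear L" "\<And>x. x \<in> S \<Longrightarrow> L x \<noteq> 0"
  shows "Ck_on k S (\<lambda>x. norm (L x))"
proof (induction k)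
  case 0
  then show ?case
    using assms(2) by (simp add: continuous_on_norm linear_continuous_on)
next
  case (Suc k)
  show ?case
  proof (rule Ck_on_SucI[OF assms(1), where D="\<lambda>x w. (L x \<bullet> L w) * inverse (norm (L x))"])
    show "((\<lambda>x. norm (L x)) has_derivative (\<lambda>w. (L x \<bullet> L w) * inverse (norm (L x)))) (at x)"
      if "x \<in> S" for x
    proof -
      have "((\<lambda>x. norm (L x)) has_derivative (\<lambda>w. L w \<bullet> sgn (L x))) (at x)"
        using has_derivative_compose[OF bounded_linear_imp_has_derivative[OF assms(2)]
            has_derivative_norm[OF assms(3)[OF that]]] .
      then show ?thesis by (simp add: sgn_div_norm inner_commute mult.commute divide_inverse)
    qed
    show "Ck_on k S (\<lambda>x. (L x \<bullet> L w) * inverse (norm (L x)))" for w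
      by (intro Ck_on_mult[OF assms(1)] Ck_on_inverse[OF assms(1) Suc]
          Ck_on_bounded_linear[OF assms(1) bounded_linear_compose[OF bounded_linear_inner_left assms(2)]])
         (simp add: assms(3))
  qed
qed

section \<open>The metric on the quotient\<close>

text \<open>Repeats the right-hand side of the theorem literally, so that it can be folded
  there.\<close>

definition metric_g1 :: "((real^3) \<times> (real^3)) two_tensor" where
  "metric_g1 m a b = 1/2 * tensor_sq (ext_d M_R) m a b
     + 1/2 * M_R m * (inverse (M_u m) * norm_du_sq m a b + inverse (M_v m) * norm_dv_sq m a b)"

lemma M_reg_iff: "m \<in> M_reg \<longleftrightarrow> fst m \<noteq> 0 \<and> snd m \<noteq> 0"
  by (simp add: M_reg_def M_u_def M_v_def)

lemma open_M_reg: "open M_reg"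
proof -
  have eq: "M_reg = (- {0}) \<times> (- {0})"
    by (auto simp: M_reg_iff)
  show ?thesis
    unfolding eq by (intro open_Times open_Compl closed_singleton)
qed

lemma ext_d_M_R:
  assumes "m \<in> M_reg"
  shows "ext_d M_R m a = (fst m \<bullet> fst a) * inverse (M_u m) + (snd m \<bullet> snd a) * inverse (M_v m)"
proof -
  have "(M_R has_derivative (\<lambda>a. fst a \<bullet> sgn (fst m) + snd a \<bullet> sgn (snd m))) (at m)"
    unfolding M_R_def[abs_def] M_u_def[abs_def] M_v_def[abs_def]
    using assms
    by (intro has_derivative_add has_derivative_compose[OF _ has_derivative_norm])
       (auto simp: M_reg_iff intro!: derivative_eq_intros)
  from ext_d_eq[OF this] show ?thesis
    by (simp add: sgn_div_norm M_u_def M_v_def inner_commute mult.commute divide_inverse)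
qed

lemma norm_du_sq_eq: "norm_du_sq m a b = fst a \<bullet> fst b"
proof -
  have "ext_d (\<lambda>p::(real^3) \<times> (real^3). fst p $ i) m c = fst c $ i" for i c
    by (intro ext_d_eq bounded_linear_imp_has_derivative bounded_linear_compose[OF bounded_linear_vec_nth]
        bounded_linear_fst)
  then show ?thesis
    by (simp add: norm_du_sq_def tensor_prod_def inner_vec_def)
qed

lemma norm_dv_sq_eq: "norm_dv_sq m a b = snd a \<bullet> snd b"
proof -
  have "ext_d (\<lambda>p::(real^3) \<times> (real^3). snd p $ i) m c = snd c $ i" for i c
    by (intro ext_d_eq bounded_linear_imp_has_derivative bounded_linear_compose[OF bounded_linear_vec_nth]
        bounded_linear_snd)
  then show ?thesis
    by (simp add: norm_dv_sq_def tensor_prod_def inner_vec_def)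
qed

text \<open>Only sums, products and inverses of norms and linear functions of \<open>m\<close> occur
  here, which matches the closure rules for \<open>Ck_on\<close>.\<close>

lemma metric_g1_eq:
  assumes "m \<in> M_reg"
  shows "metric_g1 m a b =
    1/2 * (((fst m \<bullet> fst a) * inverse (M_u m) + (snd m \<bullet> snd a) * inverse (M_v m))
         * ((fst m \<bullet> fst b) * inverse (M_u m) + (snd m \<bullet> snd b) * inverse (M_v m)))
    + 1/2 * ((M_u m + M_v m) * (inverse (M_u m) * (fst a \<bullet> fst b) + inverse (M_v m) * (snd a \<bullet> snd b)))"
  using assms
  by (simp add: metric_g1_def tensor_prod_def ext_d_M_R norm_du_sq_eq norm_dv_sq_eq M_R_def)

lemma smooth_on_metric_g1: "smooth_on M_reg (\<lambda>m. metric_g1 m a b)"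
  unfolding smooth_on_def
proof
  fix k
  have u: "Ck_on k M_reg M_u" and v: "Ck_on k M_reg M_v"
    unfolding M_u_def[abs_def] M_v_def[abs_def]
    by (intro Ck_on_norm_linear open_M_reg bounded_linear_fst bounded_linear_snd; simp add: M_reg_iff)+
  have iu: "Ck_on k M_reg (\<lambda>m. inverse (M_u m))" and iv: "Ck_on k M_reg (\<lambda>m. inverse (M_v m))"
    by (intro Ck_on_inverse open_M_reg u v; simp add: M_reg_def)+
  have lin: "Ck_on k M_reg (\<lambda>m. fst m \<bullet> c)" "Ck_on k M_reg (\<lambda>m. snd m \<bullet> c)" for c
    by (intro Ck_on_bounded_linear open_M_reg bounded_linear_compose[OF bounded_linear_inner_left]
        bounded_linear_fst bounded_linear_snd)+
  show "Ck_on k M_reg (\<lambda>m. metric_g1 m a b)"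
    by (rule Ck_on_cong[OF open_M_reg metric_g1_eq[symmetric]], assumption)
       (intro Ck_on_add Ck_on_mult Ck_on_const open_M_reg u v iu iv lin)
qed

lemma riemannian_metric_on_metric_g1: "riemannian_metric_on M_reg metric_g1"
  unfolding riemannian_metric_on_def
proof (intro conjI ballI allI impI)
  fix m a b assume m: "m \<in> M_reg"
  show "metric_g1 m a b = metric_g1 m b a"
    using m by (simp add: metric_g1_eq inner_commute)
  show "bilinear (metric_g1 m)"
    unfolding bilinear_def metric_g1_eq[OF m, abs_def]
    by (auto intro!: linearI simp: algebra_simps add_divide_distrib inner_add_left inner_add_right)
  assume a: "a \<noteq> 0"
  have uv: "M_u m > 0" "M_v m > 0"
    using m by (auto simp: M_reg_iff M_u_def M_v_def)
  \<comment> \<open>The square of dR is only semidefinite, so positivity has to come from this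
    summand.\<close>
  have "inverse (M_u m) * (fst a \<bullet> fst a) + inverse (M_v m) * (snd a \<bullet> snd a) > 0"
  proof (cases "fst a = 0")
    case True
    then have "snd a \<noteq> 0" using a by (simp add: prod_eq_iff)
    then show ?thesis using uv True by simp
  next
    case False
    then show ?thesis using uv by (simp add: add_pos_nonneg)
  qed
  then show "metric_g1 m a a > 0"
    using uv unfolding metric_g1_eq[OF m] by (intro add_nonneg_pos) auto
qed (use open_M_reg smooth_on_metric_g1 in auto)

section \<open>The Hopf map\<close>

text \<open>The Hopf map at z = p + iq, w = r + is; its last two entries are the real and imaginary
  parts of twice conj(z) w.\<close>

definition hopf :: "real \<Rightarrow> real \<Rightarrow> real \<Rightarrow> real \<Rightarrow> real^3" where
  "hopf p q r s = vector [p\<^sup>2 + q\<^sup>2 - r\<^sup>2 - s\<^sup>2, 2 * (p * r + q * s), 2 * (p * s - q * r)]"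

definition hopf_deriv ::
  "real \<Rightarrow> real \<Rightarrow> real \<Rightarrow> real \<Rightarrow> real \<Rightarrow> real \<Rightarrow> real \<Rightarrow> real \<Rightarrow> real^3" where
  "hopf_deriv p q r s a b c d = vector [2 * (p * a + q * b - r * c - s * d),
     2 * (p * c + a * r + q * d + b * s), 2 * (p * d + a * s - q * c - b * r)]"

lemma norm_hopf: "norm (hopf p q r s) = p\<^sup>2 + q\<^sup>2 + r\<^sup>2 + s\<^sup>2"
proof -
  have "hopf p q r s \<bullet> hopf p q r s = (p\<^sup>2 + q\<^sup>2 + r\<^sup>2 + s\<^sup>2)\<^sup>2"
    by (simp add: hopf_def inner_vec_def sum_3 power2_eq_square algebra_simps)
  then show ?thesis by (simp add: norm_eq_sqrt_inner)
qed

text \<open>Half the differential of the squared norm of \<open>hopf\<close>, which is n^2 for n =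
  |z|^2 + |w|^2.\<close>

lemma inner_hopf_hopf_deriv:
  "hopf p q r s \<bullet> hopf_deriv p q r s a b c d =
    2 * (p\<^sup>2 + q\<^sup>2 + r\<^sup>2 + s\<^sup>2) * (p * a + q * b + r * c + s * d)"
  by (simp add: hopf_def hopf_deriv_def inner_vec_def sum_3 power2_eq_square algebra_simps)

text \<open>The differential kills the rotation field (-q, p, -s, r), since a common phase leaves
  \<open>hopf\<close> unchanged, and scales lengths on its orthogonal complement by 2 sqrt n. The
  subtracted product is the part along that field, whose square norm is n.\<close>

lemma inner_hopf_deriv:
  "hopf_deriv p q r s a b c d \<bullet> hopf_deriv p q r s a' b' c' d' =
    4 * (p\<^sup>2 + q\<^sup>2 + r\<^sup>2 + s\<^sup>2) * (a * a' + b * b' + c * c' + d * d')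
    - 4 * (p * b - q * a + r * d - s * c) * (p * b' - q * a' + r * d' - s * c')"
  by (simp add: hopf_deriv_def inner_vec_def sum_3 power2_eq_square algebra_simps)

lemma vec3_eq_iff: "(x::real^3) = y \<longleftrightarrow> x$1 = y$1 \<and> x$2 = y$2 \<and> x$3 = y$3"
  by (simp add: vec_eq_iff forall_3)

text \<open>Constant vectors with scalar coefficients are a form that the differentiation rules can
  handle.\<close>

lemma vector3_eq_axis:
  "(vector [a, b, c] :: real^3) = a *\<^sub>R axis 1 1 + b *\<^sub>R axis 2 1 + c *\<^sub>R axis 3 1"
  by (simp add: vec3_eq_iff axis_def)

lemma hopf_surj: "\<exists>p q r s. hopf p q r s = y"
proof (cases "norm y + y$1 = 0")
  \<comment> \<open>Here y lies on the closed negative first axis, so z = 0 and |w|^2 = |y|.\<close>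
  case True
  have "(norm y)\<^sup>2 = (y$1)\<^sup>2 + (y$2)\<^sup>2 + (y$3)\<^sup>2"
    by (simp add: norm_vec_def L2_set_def sum_3)
  moreover have "(norm y)\<^sup>2 = (y$1)\<^sup>2"
    using True by (metis add_eq_0_iff power2_minus)
  ultimately have "y$2 = 0" "y$3 = 0"
    by (auto simp: sum_power2_eq_zero_iff)
  moreover have "y$1 = - norm y" using True by simp
  ultimately have "hopf 0 0 (sqrt (norm y)) 0 = y"
    by (simp add: vec3_eq_iff hopf_def)
  then show ?thesis by blast
next
  case False
  \<comment> \<open>The phase is fixed by taking z = t > 0. Then t^2 + |w|^2 = |y| and t^2 - |w|^2 =
    y_1 give t, and 2 t w = y_2 + i y_3 gives w.\<close>
  define t where "t = sqrt ((norm y + y$1) / 2)"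
  have "\<bar>y$1\<bar> \<le> norm y" by (rule component_le_norm_cart)
  then have pos: "norm y + y$1 > 0" using False by linarith
  have t: "t\<^sup>2 = (norm y + y$1) / 2" "t > 0"
    using pos by (auto simp: t_def)
  have "(norm y)\<^sup>2 = (y$1)\<^sup>2 + (y$2)\<^sup>2 + (y$3)\<^sup>2"
    by (simp add: norm_vec_def L2_set_def sum_3)
  then have yy: "(y$2)\<^sup>2 + (y$3)\<^sup>2 = (norm y + y$1) * (norm y - y$1)"
    by (simp add: power2_eq_square algebra_simps)
  have "(y$2 / (2*t))\<^sup>2 + (y$3 / (2*t))\<^sup>2 = ((y$2)\<^sup>2 + (y$3)\<^sup>2) / (4 * t\<^sup>2)"
    by (simp add: power_divide power_mult_distrib add_divide_distrib)
  also have "\<dots> = (norm y - y$1) / 2"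
    using pos by (simp add: yy t(1) field_simps)
  finally have sq: "(y$2 / (2*t))\<^sup>2 + (y$3 / (2*t))\<^sup>2 = (norm y - y$1) / 2" .
  have "t\<^sup>2 - (y$2 / (2*t))\<^sup>2 - (y$3 / (2*t))\<^sup>2 = y$1"
    unfolding diff_diff_eq sq t(1) by (simp add: field_simps)
  then have "hopf t 0 (y$2 / (2*t)) (y$3 / (2*t)) = y"
    using t(2) by (simp add: vec3_eq_iff hopf_def)
  then show ?thesis by blast
qed

lemma hopf_deriv_surj:
  assumes "hopf p q r s \<noteq> 0"
  shows "\<exists>a b c d. hopf_deriv p q r s a b c d = y"
proof -
  define n where "n = p\<^sup>2 + q\<^sup>2 + r\<^sup>2 + s\<^sup>2"
  have n: "n \<noteq> 0" using assms by (metis n_def norm_hopf norm_eq_zero)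
  \<comment> \<open>The rows of the matrix of \<open>hopf_deriv\<close> are orthogonal of square norm \<open>4 n\<close>, so its transpose
    divided by \<open>4 n\<close> is a right inverse.\<close>
  have "hopf_deriv p q r s ((p * y$1 + r * y$2 + s * y$3) / (2 * n))
      ((q * y$1 + s * y$2 - r * y$3) / (2 * n)) ((p * y$2 - r * y$1 - q * y$3) / (2 * n))
      ((q * y$2 + p * y$3 - s * y$1) / (2 * n)) = y"
    using n by (simp add: vec3_eq_iff hopf_deriv_def field_simps)
       (simp add: n_def power2_eq_square algebra_simps)
  then show ?thesis by blast
qed

section \<open>The quotient map\<close>

lemma exhaust_8:
  fixes i :: 8
  shows "i = 0 \<or> i = 1 \<or> i = 2 \<or> i = 3 \<or> i = 4 \<or> i = 5 \<or> i = 6 \<or> i = 7"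
proof (induct i)
  case (of_int z)
  then have "z = 0 \<or> z = 1 \<or> z = 2 \<or> z = 3 \<or> z = 4 \<or> z = 5 \<or> z = 6 \<or> z = 7"
    by simp arith
  then show ?case by auto
qed

lemma UNIV_8: "UNIV = {0::8, 1, 2, 3, 4, 5, 6, 7}"
  using exhaust_8 by auto

lemma sum_8: "sum f (UNIV :: 8 set) = f 0 + f 1 + f 2 + f 3 + f 4 + f 5 + f 6 + f 7"
  unfolding UNIV_8 by (simp add: ac_simps)

definition map_dQ :: "real^8 \<Rightarrow> real^8 \<Rightarrow> (real^3) \<times> (real^3)" where
  "map_dQ x a =
    (hopf_deriv (x$0) (x$1) (x$4) (x$5) (a$0) (a$1) (a$4) (a$5),
     hopf_deriv (x$2) (x$3) (x$6) (x$7) (a$2) (a$3) (a$6) (a$7))"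

lemma map_Q_eq: "map_Q x = (hopf (x$0) (x$1) (x$4) (x$5), hopf (x$2) (x$3) (x$6) (x$7))"
  by (simp add: map_Q_def hopf_def)

lemma map_Q_has_derivative: "(map_Q has_derivative map_dQ x) (at x)"
proof -
  have nth: "((\<lambda>y::real^8. y $ i) has_derivative (\<lambda>y. y $ i)) (at x)" for i
    by (intro bounded_linear_imp_has_derivative bounded_linear_vec_nth)
  show ?thesis
    unfolding map_Q_eq[abs_def] map_dQ_def[abs_def] hopf_def hopf_deriv_def vector3_eq_axis
    by (auto intro!: derivative_eq_intros nth has_derivative_Pair simp: algebra_simps)
qed

lemma pullback_map_Q: "pullback map_Q g x a b = g (map_Q x) (map_dQ x a) (map_dQ x b)"
  by (simp add: pullback_def frechet_derivative_at[OF map_Q_has_derivative, symmetric])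

lemma map_Q_surj: "\<exists>x. map_Q x = m"
proof -
  obtain p q r s where 1: "hopf p q r s = fst m" using hopf_surj by blast
  obtain p' q' r' s' where 2: "hopf p' q' r' s' = snd m" using hopf_surj by blast
  define x :: "real^8" where "x = (\<chi> i. if i = 0 then p else if i = 1 then q else if i = 4 then r
    else if i = 5 then s else if i = 2 then p' else if i = 3 then q' else if i = 6 then r' else s')"
  have "map_Q x = m" by (simp add: map_Q_eq x_def 1 2)
  then show ?thesis by blast
qed

text \<open>Every tangent vector on \<open>M_reg\<close> lifts, so a pullback determines the tensor;
  this gives uniqueness of the pushdown.\<close>

lemma map_dQ_surj:
  assumes "map_Q x \<in> M_reg"
  shows "\<exists>a. map_dQ x a = y"
proof -
  obtain p q r s where 1: "hopf_deriv (x$0) (x$1) (x$4) (x$5) p q r s = fst y"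
    using hopf_deriv_surj assms by (force simp: M_reg_iff map_Q_eq)
  obtain p' q' r' s' where 2: "hopf_deriv (x$2) (x$3) (x$6) (x$7) p' q' r' s' = snd y"
    using hopf_deriv_surj assms by (force simp: M_reg_iff map_Q_eq)
  define a :: "real^8" where "a = (\<chi> i. if i = 0 then p else if i = 1 then q else if i = 4 then r
    else if i = 5 then s else if i = 2 then p' else if i = 3 then q' else if i = 6 then r' else s')"
  have "map_dQ x a = y" by (simp add: map_dQ_def a_def 1 2)
  then show ?thesis by blast
qed

section \<open>The tensors on \<open>real^8\<close> and the decomposition of
  \<open>metric_h 1\<close>\<close>

lemma eucl_e_eq: "eucl_e x a b = a \<bullet> b"
proof -
  have "ext_d (\<lambda>y::real^8. y $ i) x c = c $ i" for i c
    by (intro ext_d_eq bounded_linear_imp_has_derivative bounded_linear_vec_nth)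
  then show ?thesis
    by (simp add: eucl_e_def tensor_prod_def inner_vec_def)
qed

lemma ext_d_R8: "ext_d R8 x a = 2 * (x \<bullet> a)"
proof -
  have "R8 = (\<lambda>y. y \<bullet> y)"
    by (auto simp: R8_def inner_vec_def power2_eq_square)
  moreover have "((\<lambda>y. y \<bullet> y) has_derivative (\<lambda>a. 2 * (x \<bullet> a))) (at x)"
    by (auto intro!: derivative_eq_intros simp: inner_commute)
  ultimately show ?thesis by (simp add: ext_d_eq)
qed

text \<open>At c = 1 the coefficient 1 - c vanishes, so \<open>metric_h 1\<close> is built from dR,
  e and \<alpha>_1. These, like the pullback and \<open>form_Theta 1\<close>, are expressible
  through the contributions of the two factors.\<close>

lemma metric_h_1_decomposition:
  assumes "map_Q x \<in> M_reg"
  shows "metric_h 1 x a b =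
    pullback map_Q metric_g1 x a b + 1/4 * fun_N 1 x * tensor_sq (form_Theta 1) x a b"
proof -
  define u where "u = (x$0)\<^sup>2 + (x$1)\<^sup>2 + (x$4)\<^sup>2 + (x$5)\<^sup>2"
  define v where "v = (x$2)\<^sup>2 + (x$3)\<^sup>2 + (x$6)\<^sup>2 + (x$7)\<^sup>2"
  \<comment> \<open>\<open>tu\<close> and \<open>tv\<close> are the forms
    \<open>\<theta>\<^sub>u\<close> and \<open>\<theta>\<^sub>v\<close> at \<open>x\<close>;
    \<open>iu\<close> and \<open>iv\<close> below are the two summands of e.\<close>
  define tu where "tu c = x$0 * c$1 - x$1 * c$0 + x$4 * c$5 - x$5 * c$4" for c :: "real^8"
  define tv where "tv c = x$2 * c$3 - x$3 * c$2 + x$6 * c$7 - x$7 * c$6" for c :: "real^8"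
  define iu where "iu c d = c$0 * d$0 + c$1 * d$1 + c$4 * d$4 + c$5 * d$5" for c d :: "real^8"
  define iv where "iv c d = c$2 * d$2 + c$3 * d$3 + c$6 * d$6 + c$7 * d$7" for c d :: "real^8"
  have Mu: "M_u (map_Q x) = u" and Mv: "M_v (map_Q x) = v"
    by (simp_all add: M_u_def M_v_def map_Q_eq norm_hopf u_def v_def)
  have uv: "u \<noteq> 0" "v \<noteq> 0"
    using assms Mu Mv by (auto simp: M_reg_def)
  have inner: "c \<bullet> d = iu c d + iv c d" for c d :: "real^8"
    by (simp add: inner_vec_def sum_8 iu_def iv_def)
  have X: "vf_X x \<bullet> c = tu c + tv c" for c
    by (simp add: inner_vec_def sum_8 vf_X_def axis_def tu_def tv_def)
  have Y1: "vf_Y1 x \<bullet> c = tu c - tv c" for c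
    by (simp add: inner_vec_def sum_8 vf_Y1_def axis_def tu_def tv_def)
  have tX: "tu (vf_X x) = u" "tv (vf_X x) = v"
    by (simp_all add: tu_def tv_def u_def v_def vf_X_def axis_def power2_eq_square)
  \<comment> \<open>X is tangent to the spheres, so dR(X) = 0.\<close>
  have xX: "x \<bullet> vf_X x = 0"
    by (simp add: inner_vec_def sum_8 vf_X_def axis_def algebra_simps)
  have R: "R8 x = u + v"
    by (simp add: R8_def sum_8 u_def v_def)
  have h: "metric_h 1 x c d = 2 * (x \<bullet> c) * (x \<bullet> d) + 2 * (u + v) * (c \<bullet> d)
      - 2 * (tu c - tv c) * (tu d - tv d)" for c d
    by (simp add: metric_h_def tensor_prod_def ext_d_R8 eucl_e_eq R form_alpha1_def Y1)
  have hX: "metric_h 1 x (vf_X x) c = 4 * (v * tu c + u * tv c)" for c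
    by (simp add: h xX X tX algebra_simps)
  have N: "fun_N 1 x = 8 * (u * v)"
    by (simp add: fun_N_def hX tX)
  have Theta: "form_Theta 1 x c = tu c * inverse u + tv c * inverse v" for c
    using uv by (simp add: form_Theta_def N hX field_simps)
  have 1: "fst (map_Q x) \<bullet> fst (map_dQ x c) = 2 * u * iu x c"
    "snd (map_Q x) \<bullet> snd (map_dQ x c) = 2 * v * iv x c" for c
    by (simp_all add: map_Q_eq map_dQ_def inner_hopf_hopf_deriv u_def v_def iu_def iv_def)
  have 2: "fst (map_dQ x c) \<bullet> fst (map_dQ x d) = 4 * u * iu c d - 4 * tu c * tu d"
    "snd (map_dQ x c) \<bullet> snd (map_dQ x d) = 4 * v * iv c d - 4 * tv c * tv d" for c d
    by (simp_all add: map_dQ_def inner_hopf_deriv u_def v_def iu_def iv_def tu_def tv_def algebra_simps)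
  \<comment> \<open>Turns the pulled back dR into 2 x . dx, free of inverses.\<close>
  have cancel: "2 * u * c * inverse u = 2 * c" "2 * v * c * inverse v = 2 * c" for c
    using uv by simp_all
  have g: "pullback map_Q metric_g1 x a b =
      1/2 * ((2 * iu x a + 2 * iv x a) * (2 * iu x b + 2 * iv x b))
      + 1/2 * ((u + v) * (inverse u * (4 * u * iu a b - 4 * tu a * tu b)
        + inverse v * (4 * v * iv a b - 4 * tv a * tv b)))"
    by (simp only: pullback_map_Q metric_g1_eq[OF assms] Mu Mv 1 2 cancel)
  \<comment> \<open>With \<open>p * u = 1\<close> and \<open>q * v = 1\<close> as relations, the
    claim becomes a polynomial identity modulo an ideal.\<close>
  define p where "p = inverse u"
  define q where "q = inverse v"
  have pq: "p * u = 1" "q * v = 1"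
    using uv by (simp_all add: p_def q_def)
  \<comment> \<open>\<open>A\<close>, \<open>B\<close>, \<open>C\<close>, \<open>T\<close>,
    \<open>S\<close> stand for \<open>iu x a\<close>, \<open>iu x b\<close>, \<open>iu a b\<close>,
    \<open>tu a\<close>, \<open>tu b\<close>; primes mark the counterparts with \<open>iv\<close>
    and \<open>tv\<close>.\<close>
  have "2 * (A + A') * (B + B') + 2 * (u + v) * (C + C') - 2 * (T - T') * (S - S') =
      1/2 * ((2 * A + 2 * A') * (2 * B + 2 * B'))
      + 1/2 * ((u + v) * (p * (4 * u * C - 4 * T * S) + q * (4 * v * C' - 4 * T' * S')))
      + 1/4 * (8 * (u * v)) * ((T * p + T' * q) * (S * p + S' * q))"
    for A A' B B' C C' T T' S S'
    using pq by algebra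
  then show ?thesis
    unfolding g N tensor_prod_def Theta h inner p_def q_def .
qed

theorem theorem4p7:
  fixes g :: "(real^3) \<times> (real^3) \<Rightarrow> (real^3) \<times> (real^3) \<Rightarrow> (real^3) \<times> (real^3) \<Rightarrow> real"
  shows "is_pushdown 1 g \<longleftrightarrow>
    (\<forall>m\<in>M_reg. \<forall>a b.
       g m a b = 1/2 * tensor_sq (ext_d M_R) m a b
         + 1/2 * M_R m * (inverse (M_u m) * norm_du_sq m a b + inverse (M_v m) * norm_dv_sq m a b))"
  unfolding metric_g1_def[symmetric]
proof
  assume g: "is_pushdown 1 g"
  show "\<forall>m\<in>M_reg. \<forall>a b. g m a b = metric_g1 m a b"
  proof (intro ballI allI)
    fix m a b assume m: "m \<in> M_reg"
    obtain x where x: "map_Q x = m" using map_Q_surj by blast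
    obtain a' b' where "map_dQ x a' = a" "map_dQ x b' = b"
      using map_dQ_surj m x by metis
    \<comment> \<open>Both decompositions of \<open>metric_h 1\<close> contain the same
      \<open>form_Theta\<close> term, which cancels.\<close>
    moreover have "pullback map_Q g x a' b' = pullback map_Q metric_g1 x a' b'"
      using g metric_h_1_decomposition[of x a' b'] m x by (simp add: is_pushdown_def)
    ultimately show "g m a b = metric_g1 m a b"
      by (simp add: pullback_map_Q x)
  qed
next
  assume eq: "\<forall>m\<in>M_reg. \<forall>a b. g m a b = metric_g1 m a b"
  then have "g m = metric_g1 m" if "m \<in> M_reg" for m
    using that by blast
  \<comment> \<open>\<open>g\<close> agrees with \<open>metric_g1\<close> only on
    \<open>M_reg\<close>, so smoothness is transferred by congruence on this open set.\<close>
  moreover have "smooth_on M_reg (\<lambda>m. g m a b)" for a b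
    using smooth_on_metric_g1[of a b] unfolding smooth_on_def
    by (rule all_forward, elim Ck_on_cong[OF open_M_reg, rotated]) (simp add: eq)
  ultimately have "riemannian_metric_on M_reg g"
    using riemannian_metric_on_metric_g1 by (simp add: riemannian_metric_on_def)
  then show "is_pushdown 1 g"
    unfolding is_pushdown_def pullback_map_Q
    using eq metric_h_1_decomposition[unfolded pullback_map_Q] by metis
qed

end
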